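(* For all integers $n\geq m\geq 3$, $$R(\mathcal{P}^3_n,\mathcal{P}^3_m)=2n+\Big\lfloor\frac{m+1}{2}\Big\rfloor .$$
   Context: The 3-uniform loose path $\mathcal{P}^3_n$ (of length $n$) is the hypergraph with vertex set $\{v_1,\dots,v_{2n+1}\}$ and the $n$ edges $\{v_{2i+1},v_{2i+2},v_{2i+3}\}$, $i=0,1,\dots,n-1$. For 3-uniform hypergraphs $\mathcal{H},\mathcal{G}$, the Ramsey number $R(\mathcal{H},\mathcal{G})$ is the smallest $N$ such that every red-blue coloring of the edges of the complete 3-uniform hypergraph $\mathcal{K}^3_N$ on $N$ vertices contains a red copy of $\mathcal{H}$ or a blue copy of $\mathcal{G}$ (copies are not necessarily induced). *)

theory Defs
  imports "HOL-Library.Ramsey"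
begin

text \<open>A hypergraph is a pair of a vertex set and a set of edges.\<close>

type_synonym 'a hypergraph = "'a set \<times> 'a set set"

abbreviation hverts :: "'a hypergraph \<Rightarrow> 'a set" where
  "hverts \<equiv> fst"

abbreviation hedges :: "'a hypergraph \<Rightarrow> 'a set set" where
  "hedges \<equiv> snd"

definition uniform3 :: "'a hypergraph \<Rightarrow> bool" where
  "uniform3 H \<longleftrightarrow> finite (hverts H) \<and> hedges H \<subseteq> [hverts H]\<^bsup>3\<^esup>"

definition complete3 :: "nat \<Rightarrow> nat hypergraph" where
  "complete3 N = ({1..N}, [{1..N}]\<^bsup>3\<^esup>)"

definition loose_path3 :: "nat \<Rightarrow> nat hypergraph" where
  "loose_path3 n = ({1..2*n+1}, {{2*i+1, 2*i+2, 2*i+3} | i. i < n})"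

text \<open>Copies are not necessarily induced: \<open>K\<close> may have further edges on the image of \<open>f\<close>.\<close>

definition contains_copy :: "'b hypergraph \<Rightarrow> 'a hypergraph \<Rightarrow> bool" where
  "contains_copy K H \<longleftrightarrow>
     (\<exists>f. inj_on f (hverts H) \<and> f ` hverts H \<subseteq> hverts K \<and> (\<forall>e\<in>hedges H. f ` e \<in> hedges K))"

datatype color = Red | Blue

definition color_class :: "'a hypergraph \<Rightarrow> ('a set \<Rightarrow> color) \<Rightarrow> color \<Rightarrow> 'a hypergraph" where
  "color_class K c x = (hverts K, {e \<in> hedges K. c e = x})"

text \<open>A coloring is a total function on vertex sets; only its values on edges of
  \<^term>\<open>complete3 N\<close> matter.\<close>

definition arrows :: "nat \<Rightarrow> 'a hypergraph \<Rightarrow> 'b hypergraph \<Rightarrow> bool" where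
  "arrows N H G \<longleftrightarrow>
     (\<forall>c. contains_copy (color_class (complete3 N) c Red) H
        \<or> contains_copy (color_class (complete3 N) c Blue) G)"

definition ramsey_number :: "'a hypergraph \<Rightarrow> 'b hypergraph \<Rightarrow> nat" where
  "ramsey_number H G = (LEAST N. arrows N H G)"

text \<open>The \<open>LEAST\<close> above is attained whenever both arguments are 3-uniform hypergraphs.\<close>

lemma uniform3_loose_path3: "uniform3 (loose_path3 n)"
  by (auto simp: uniform3_def loose_path3_def nsets_def)

lemma contains_copy_mono_clique:
  assumes H: "uniform3 H" and S: "finite S" "card S = card (hverts H)" "S \<subseteq> hverts K"
    and E: "[S]\<^bsup>3\<^esup> \<subseteq> hedges K"
  shows "contains_copy K H"
proof -
  obtain f where f: "bij_betw f (hverts H) S"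
    using H S finite_same_card_bij unfolding uniform3_def by metis
  have "f ` e \<in> hedges K" if "e \<in> hedges H" for e
  proof -
    have e: "e \<subseteq> hverts H" "finite e" "card e = 3"
      using that H by (auto simp: uniform3_def nsets_def)
    then have "card (f ` e) = 3"
      using f by (metis bij_betw_def card_image inj_on_subset)
    then have "f ` e \<in> [S]\<^bsup>3\<^esup>"
      using e f by (auto simp: nsets_def bij_betw_def)
    then show ?thesis using E by blast
  qed
  then show ?thesis
    using f S unfolding contains_copy_def bij_betw_def by blast
qed

lemma arrows_exists:
  assumes "uniform3 H" "uniform3 G"
  shows "\<exists>N. arrows N H G"
proof -
  obtain N :: nat where N: "partn_lst {..<N} [card (hverts H), card (hverts G)] 3"
    using ramsey_full by blast
  have "arrows N H G"
    unfolding arrows_def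
  proof
    fix c :: "nat set \<Rightarrow> color"
    let ?g = "\<lambda>e. if c (Suc ` e) = Red then 0 else (1::nat)"
    have "?g \<in> [{..<N}]\<^bsup>3\<^esup> \<rightarrow> {..<length [card (hverts H), card (hverts G)]}"
      by auto
    then obtain i S where i: "i < 2"
      and S: "S \<in> [{..<N}]\<^bsup>([card (hverts H), card (hverts G)] ! i)\<^esup>"
      and g: "?g ` [S]\<^bsup>3\<^esup> \<subseteq> {i}"
      using partn_lstE[OF N] by (metis length_Cons list.size(3) numeral_2_eq_2)
    have T: "finite (Suc ` S)" "card (Suc ` S) = [card (hverts H), card (hverts G)] ! i"
      "Suc ` S \<subseteq> {1..N}"
      using S by (auto simp: nsets_def card_image)
    have "c e = (if i = 0 then Red else Blue) \<and> e \<in> [{1..N}]\<^bsup>3\<^esup>" if e: "e \<in> [Suc ` S]\<^bsup>3\<^esup>" for e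
    proof -
      obtain d where d: "d \<subseteq> S" "e = Suc ` d"
        using e unfolding nsets_def by (blast elim: subset_imageE)
      then have "d \<in> [S]\<^bsup>3\<^esup>"
        using e by (auto simp: nsets_def card_image finite_image_iff)
      then have "?g d = i" using g by blast
      moreover have "e \<in> [{1..N}]\<^bsup>3\<^esup>"
        using e T(3) by (auto simp: nsets_def)
      ultimately show ?thesis
        using d by (cases "c e") auto
    qed
    then have E: "[Suc ` S]\<^bsup>3\<^esup> \<subseteq> hedges (color_class (complete3 N) c (if i = 0 then Red else Blue))"
      by (auto simp: color_class_def complete3_def)
    have V: "Suc ` S \<subseteq> hverts (color_class (complete3 N) c x)" for x
      using T(3) by (simp add: color_class_def complete3_def)
    consider "i = 0" | "i = 1" using i by linarith
    then show "contains_copy (color_class (complete3 N) c Red) H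
        \<or> contains_copy (color_class (complete3 N) c Blue) G"
    proof cases
      case 1
      then show ?thesis
        using contains_copy_mono_clique[OF assms(1) T(1) _ V, of Red] T(2) E by simp
    next
      case 2
      then show ?thesis
        using contains_copy_mono_clique[OF assms(2) T(1) _ V, of Blue] T(2) E by simp
    qed
  qed
  then show ?thesis ..
qed

lemma arrows_ramsey_number:
  assumes "uniform3 H" "uniform3 G"
  shows "arrows (ramsey_number H G) H G"
  using arrows_exists[OF assms] unfolding ramsey_number_def by (metis LeastI)

end

theory Submission
  imports Defs
begin

text \<open>
  Lower bound: colour a triple red iff it lies in a fixed set of \<open>2n\<close> vertices. Red paths are then
  too short, and every other edge of a blue path of length \<open>m\<close> needs its own vertex outside this set.

  Upper bound: by induction (on the diagonal \<open>n = m\<close> with the colours exchanged) there is a red path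
  \<open>L\<close> with \<open>n - 1\<close> edges, and we may assume that there is no red path with \<open>n\<close> edges. Let \<open>W\<close> be the
  set of vertices outside \<open>L\<close>. Cut the end of \<open>L\<close> into pairs of consecutive edges \<open>abc\<close>, \<open>cde\<close>. Since the
  pair cannot be replaced by three red edges from \<open>a\<close> to \<open>e\<close> with two new vertices of \<open>W\<close>, one of two
  things happens. Either all vertices of \<open>W\<close> but one are pairwise joined by blue paths of length two
  through \<open>{a,b,c,d}\<close>; or every \<open>w \<in> W\<close> forms blue triples with \<open>ab\<close>, \<open>be\<close>, \<open>ce\<close>, and with \<open>cf\<close>, \<open>df\<close> if
  \<open>efg\<close> is the next edge of \<open>L\<close>, so that \<open>a b e\<close> and \<open>c f d\<close> serve for this pair and the next one.
  Linking these pieces through \<open>W\<close> gives a blue path \<open>Q\<close> with two edges per pair which leaves one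
  of the last two vertices \<open>u\<close> of \<open>L\<close> and one vertex \<open>z\<close> of \<open>W\<close> unused.

  If \<open>m\<close> is odd, \<open>(m - 1) / 2\<close> pairs and the edge from the end of \<open>Q\<close> through \<open>u\<close> to \<open>z\<close> give \<open>m\<close> blue edges.
  If \<open>m\<close> is even, \<open>(m - 2) / 2\<close> pairs leave the first two vertices \<open>v0\<close>, \<open>v1\<close> of \<open>L\<close> free, and \<open>Q\<close> is
  prolonged by \<open>v0, u, v1, z\<close>; if one of these two edges were red, it would close \<open>L\<close> to a red
  cycle, and then the triples consisting of a vertex off the cycle and a suitable pair on it are
  all blue, which again yields a blue path of length \<open>m\<close>.
\<close>

subsection \<open>Loose paths as vertex lists\<close>

text \<open>Distinctness is kept out, so that paths can be cut and rejoined by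
  \<open>lpath_append_iff\<close> alone.\<close>

fun lpath :: "('a set \<Rightarrow> bool) \<Rightarrow> 'a list \<Rightarrow> bool" where
  "lpath C [] = False"
| "lpath C [x] = True"
| "lpath C [x, y] = False"
| "lpath C (x # y # z # xs) = (C {x, y, z} \<and> lpath C (z # xs))"

definition has_lpath :: "('a set \<Rightarrow> bool) \<Rightarrow> 'a set \<Rightarrow> nat \<Rightarrow> bool" where
  "has_lpath C V n \<longleftrightarrow> (\<exists>xs. lpath C xs \<and> distinct xs \<and> set xs \<subseteq> V \<and> length xs = 2 * n + 1)"

lemma has_lpathI:
  "lpath C xs \<Longrightarrow> distinct xs \<Longrightarrow> set xs \<subseteq> V \<Longrightarrow> length xs = 2 * n + 1 \<Longrightarrow> has_lpath C V n"
  unfolding has_lpath_def by blast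

lemma odd_length_lpath: "lpath C xs \<Longrightarrow> odd (length xs)"
  by (induction C xs rule: lpath.induct) auto

text \<open>Even length of \<open>xs\<close> makes \<open>z\<close> a joint or an end, so no edge
  straddles the cut.\<close>

lemma lpath_append_iff:
  "even (length xs) \<Longrightarrow> lpath C (xs @ z # ys) \<longleftrightarrow> lpath C (xs @ [z]) \<and> lpath C (z # ys)"
proof (induction xs rule: induct_list012)
  case (3 x y zs)
  then show ?case by (cases zs) auto
qed auto

lemma lpath_nth:
  "lpath C xs \<Longrightarrow> 2 * i + 2 < length xs \<Longrightarrow> C {xs ! (2 * i), xs ! (2 * i + 1), xs ! (2 * i + 2)}"
proof (induction C xs arbitrary: i rule: lpath.induct)
  case (4 C x y z xs)
  then show ?case by (cases i) auto
qed auto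

lemma lpath_map_upt:
  assumes "\<And>i. i < k \<Longrightarrow> C {f (s + 2 * i), f (s + 2 * i + 1), f (s + 2 * i + 2)}"
  shows "lpath C (map f [s..<s + 2 * k + 1])"
  using assms
proof (induction k)
  case (Suc k)
  have "lpath C (map f [s..<s + 2 * k] @ [f (s + 2 * k)])"
    using Suc.IH Suc.prems by simp
  then have "lpath C (map f [s..<s + 2 * k] @ f (s + 2 * k) # [f (s + 2 * k + 1), f (s + 2 * k + 2)])"
    using Suc.prems[of k] by (subst lpath_append_iff) simp_all
  then show ?case by simp
qed simp

lemma lpath_snoc:
  assumes "lpath C Q" "C {last Q, y, z}"
  shows "lpath C (Q @ [y, z])"
proof -
  obtain Q' u where Q: "Q = Q' @ [u]"
    using assms(1) by (cases Q rule: rev_cases) auto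
  have "even (length Q')"
    using odd_length_lpath[OF assms(1)] Q by simp
  then show ?thesis
    using assms lpath_append_iff[of Q' C u "[y, z]"] Q by simp
qed

lemma length_ge_4E:
  assumes "4 \<le> length xs"
  obtains b c d e ys where "xs = b # c # d # e # ys"
  using assms by (auto simp: numeral_eq_Suc Suc_le_length_iff)

lemma obtain_notin_smaller:
  assumes "finite S" "finite T" "card T < card S"
  obtains y where "y \<in> S - T"
  using assms by (metis card_mono not_less subsetI DiffI)

subsection \<open>Red paths one edge short of the forbidden length\<close>

locale path_free =
  fixes r :: "'a set \<Rightarrow> bool" and V :: "'a set" and n :: nat
  assumes free: "\<not> has_lpath r V n"
begin

abbreviation blue :: "'a set \<Rightarrow> bool" where
  "blue e \<equiv> \<not> r e"

definition max_red_path :: "'a list \<Rightarrow> bool" where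
  "max_red_path L \<longleftrightarrow> lpath r L \<and> distinct L \<and> set L \<subseteq> V \<and> length L + 1 = 2 * n"

definition linked :: "'a set \<Rightarrow> 'a \<Rightarrow> 'a \<Rightarrow> bool" where
  "linked S x y \<longleftrightarrow>
     (\<exists>p q s. {p, q, s} \<subseteq> S \<and> distinct [p, q, s] \<and> blue {x, p, q} \<and> blue {q, s, y})"

text \<open>The parities put \<open>a\<close> and \<open>e\<close> at joints, so the stretch between
  them can be exchanged. Two more vertices mean one more edge, hence a red path with n
  edges.\<close>

lemma no_detour:
  assumes "max_red_path (pre @ a # mid @ e # post)" "even (length pre)" "odd (length mid)"
    and "lpath r (a # mid' @ [e])" "distinct mid'" "length mid' = length mid + 2"
    and "set mid' \<subseteq> set mid \<union> W" "W \<subseteq> V - set (pre @ a # mid @ e # post)"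
  shows False
proof -
  have "lpath r (pre @ a # mid @ e # post)"
    using assms(1) by (simp add: max_red_path_def)
  then have "lpath r (pre @ [a])" "lpath r (a # mid @ e # post)"
    using lpath_append_iff[OF assms(2)] by blast+
  moreover from this have "lpath r (e # post)"
    using assms(3) lpath_append_iff[of "a # mid" r e post] by simp
  ultimately have "lpath r (pre @ a # mid' @ e # post)"
    using assms(2-4,6) lpath_append_iff[of pre r a "mid' @ e # post"]
      lpath_append_iff[of "a # mid'" r e post] by simp
  moreover have "distinct (pre @ a # mid' @ e # post)"
    using assms(1,5,7,8) unfolding max_red_path_def by auto
  moreover have "set (pre @ a # mid' @ e # post) \<subseteq> V"
    using assms(1,7,8) unfolding max_red_path_def by auto
  moreover have "length (pre @ a # mid' @ e # post) = 2 * n + 1"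
    using assms(1,6) unfolding max_red_path_def by simp
  ultimately show False
    using free has_lpathI by blast
qed

lemma swap_last:
  assumes "max_red_path (xs @ [c, d, e])"
  shows "max_red_path (xs @ [c, e, d])"
proof -
  have "even (length xs)"
    using assms odd_length_lpath[of r "xs @ [c, d, e]"] unfolding max_red_path_def by simp
  then show ?thesis
    using assms lpath_append_iff[of xs r c "[d, e]"] lpath_append_iff[of xs r c "[e, d]"]
    unfolding max_red_path_def by (auto simp: insert_commute)
qed

lemma swap_hd:
  assumes "max_red_path (a # b # c # xs)"
  shows "max_red_path (b # a # c # xs)"
  using assms unfolding max_red_path_def by (auto simp: insert_commute)

lemma blue_end:
  assumes "max_red_path L" "x \<in> V - set L" "y \<in> V - set L" "x \<noteq> y"
  shows "blue {last L, x, y}"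
proof
  assume red: "r {last L, x, y}"
  obtain xs u where L: "L = xs @ [u]"
    using assms(1) by (cases L rule: rev_cases) (auto simp: max_red_path_def)
  have "even (length xs)"
    using assms(1) odd_length_lpath[of r L] unfolding max_red_path_def L by simp
  then have "lpath r (xs @ [u, x, y])"
    using assms(1) red lpath_append_iff[of xs r u "[x, y]"] unfolding max_red_path_def L by simp
  then have "has_lpath r V n"
    using assms unfolding max_red_path_def L by (intro has_lpathI[of r "xs @ [u, x, y]"]) auto
  with free show False ..
qed

end

subsection \<open>Two consecutive red edges\<close>

text \<open>\<open>W\<close> need not contain every vertex off the path: the chain construction
  shrinks it as vertices are used up.\<close>

locale two_edges = path_free +
  fixes pre post :: "'a list" and a b c d e :: 'a and W :: "'a set"
  assumes max_red_path: "max_red_path (pre @ [a, b, c, d, e] @ post)" and even_pre: "even (length pre)"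
    and W: "W \<subseteq> V - set (pre @ [a, b, c, d, e] @ post)"
begin

lemma red: "r {a, b, c}" "r {c, d, e}" "r {d, c, e}"
proof -
  show "r {a, b, c}" "r {c, d, e}"
    using max_red_path even_pre lpath_append_iff[of pre r a "[b, c, d, e] @ post"]
    by (auto simp: max_red_path_def)
  then show "r {d, c, e}" by (simp add: insert_commute)
qed

lemma dist: "distinct [a, b, c, d, e]"
  using max_red_path by (auto simp: max_red_path_def)

lemma notin: "a \<notin> W" "b \<notin> W" "c \<notin> W" "d \<notin> W" "e \<notin> W"
  using W by auto

lemma detour:
  assumes "r {a, p, q}" "r {q, s, t}" "r {t, u, e}" "distinct [p, q, s, t, u]"
    and "{p, q, s, t, u} \<subseteq> {b, c, d} \<union> W"
  shows False
proof (rule no_detour)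
  show "max_red_path (pre @ a # [b, c, d] @ e # post)" using max_red_path by simp
  show "lpath r (a # [p, q, s, t, u] @ [e])" using assms by simp
  show "set [p, q, s, t, u] \<subseteq> set [b, c, d] \<union> W" using assms(5) by simp
  show "W \<subseteq> V - set (pre @ a # [b, c, d] @ e # post)" using W by simp
qed (use even_pre assms(4) in simp_all)

text \<open>Here four edges replace three. The last one is the old edge \<open>{e, f, g}\<close>,
  entered through \<open>f\<close> instead of \<open>e\<close>.\<close>

lemma detour3:
  assumes "post = f # g # post'" 
    and "r {a, p, q}" "r {q, s, t}" "r {t, u, f}" "distinct [p, q, s, t, u]" "f \<notin> {p, q, s, t, u}"
    and "{p, q, s, t, u} \<subseteq> {b, c, d} \<union> W"
  shows False
proof (rule no_detour)
  have M: "max_red_path ((pre @ [a, b, c, d]) @ e # f # g # post')"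
    using max_red_path assms(1) by simp
  then have "r {e, f, g}"
    using even_pre lpath_append_iff[of "pre @ [a, b, c, d]" r e "f # g # post'"]
    unfolding max_red_path_def by simp
  then show "lpath r (a # [p, q, s, t, u, f, e] @ [g])" using assms by (simp add: insert_commute)
  show "max_red_path (pre @ a # [b, c, d, e, f] @ g # post')" using M by simp
  show "distinct [p, q, s, t, u, f, e]"
    using assms notin dist M by (auto simp: max_red_path_def)
  show "set [p, q, s, t, u, f, e] \<subseteq> set [b, c, d, e, f] \<union> W" using assms(7) by auto
  show "W \<subseteq> V - set (pre @ a # [b, c, d, e, f] @ g # post')" using W assms(1) by simp
qed (use even_pre in simp_all)

text \<open>On the lists a, x, b, y, c, d, e and a, x, b, y, d, c, e the first and last triples are
  red, so \<open>detour\<close> makes the middle one blue.\<close>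

lemma blue_cross:
  assumes "x \<in> W" "y \<in> W" "x \<noteq> y" "r {x, a, b}"
  shows "blue {y, b, c}" "blue {y, b, d}"
proof -
  have "r {a, x, b}" using assms(4) by (simp add: insert_commute)
  moreover have "distinct [x, b, y, c, d]" "distinct [x, b, y, d, c]"
    using assms(1-3) notin dist by auto
  ultimately have "blue {b, y, c}" "blue {b, y, d}"
    using detour[of x b y c d] detour[of x b y d c] red assms(1,2) by auto
  then show "blue {y, b, c}" "blue {y, b, d}" by (simp_all add: insert_commute)
qed

text \<open>With \<open>{x, a, b}\<close> blue, a blue triple of \<open>y\<close>, one of
  \<open>a\<close>, \<open>b\<close> and one of \<open>c\<close>, \<open>d\<close> would complete a
  link.\<close>

lemma unlinked_cross:
  assumes "\<not> linked {a, b, c, d} x y" "blue {x, a, b}"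
  shows "r {a, c, y}" "r {a, d, y}" "r {b, c, y}" "r {b, d, y}"
proof -
  have nl: "r {q, s, y}"
    if "blue {x, p, q}" "{p, q, s} \<subseteq> {a, b, c, d}" "distinct [p, q, s]" for p q s
    using assms(1) that unfolding linked_def by blast
  have "blue {x, b, a}" using assms(2) by (simp add: insert_commute)
  then show "r {a, c, y}" "r {a, d, y}" "r {b, c, y}" "r {b, d, y}"
    using nl[of b a c] nl[of b a d] nl[of a b c] nl[of a b d] assms(2) dist by auto
qed

lemma linked_sym:
  assumes "linked S x y"
  shows "linked S y x"
proof -
  obtain p q s where "{p, q, s} \<subseteq> S" "distinct [p, q, s]" "blue {x, p, q}" "blue {q, s, y}"
    using assms unfolding linked_def by blast
  then have "{s, q, p} \<subseteq> S" "distinct [s, q, p]" "blue {y, s, q}" "blue {q, p, x}"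
    by (auto simp: insert_commute)
  then show ?thesis unfolding linked_def by blast
qed

text \<open>A detour whose first two edges are red through \<open>v\<close> must have a blue edge at
  \<open>w\<close>; for \<open>{w, b, e}\<close> it is a, c, v, d, b, w, e. The triples with
  \<open>f\<close> come from \<open>detour3\<close> in the same way.\<close>

lemma blue_from_cross:
  assumes "v \<in> W" "w \<in> W" "v \<noteq> w"
    and "r {a, c, v}" "r {a, d, v}" "r {b, c, v}" "r {b, d, v}"
  shows "blue {w, b, e}" "blue {w, c, e}"
    "post = f # g # post' \<Longrightarrow> blue {w, c, f}" "post = f # g # post' \<Longrightarrow> blue {w, d, f}"
proof -
  have d: "distinct [c, v, d, b, w]" "distinct [d, v, b, c, w]" "distinct [c, v, b, d, w]"
    using assms(1-3) notin dist by auto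
  have rr: "r {v, d, b}" "r {v, b, c}" "r {v, b, d}"
    using assms(6,7) by (simp_all add: insert_commute)
  show "blue {w, b, e}"
    using detour[of c v d b w] d assms(1,2,4) rr by (auto simp: insert_commute[of w b])
  show "blue {w, c, e}"
    using detour[of d v b c w] d assms(1,2,5) rr by (auto simp: insert_commute[of w c])
  assume post: "post = f # g # post'"
  have f: "f \<notin> {c, v, d, b, w}"
    using post max_red_path W assms(1,2) by (auto simp: max_red_path_def)
  show "blue {w, c, f}"
    using detour3[OF post, of d v b c w] d f assms(1,2,5) rr by (auto simp: insert_commute[of w c])
  show "blue {w, d, f}"
    using detour3[OF post, of c v b d w] d f assms(1,2,4) rr by (auto simp: insert_commute[of w d])
qed

text \<open>If some \<open>{z, a, b}\<close> is red, \<open>blue_cross\<close> links all other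
  vertices by x, c, b, d, y. Otherwise all \<open>{w, a, b}\<close> are blue, and an unlinked pair
  forces the red triples from which \<open>blue_from_cross\<close> derives rigidity.\<close>

lemma flexible_or_rigid:
  obtains (flexible) z where
      "\<And>x y. x \<in> W - {z} \<Longrightarrow> y \<in> W - {z} \<Longrightarrow> x \<noteq> y \<Longrightarrow> linked {a, b, c, d} x y"
  | (rigid) "\<And>w. w \<in> W \<Longrightarrow> blue {w, a, b} \<and> blue {w, b, e} \<and> blue {w, c, e}"
      "\<And>w f g post'. w \<in> W \<Longrightarrow> post = f # g # post' \<Longrightarrow> blue {w, c, f} \<and> blue {w, d, f}"
proof (cases "\<exists>z\<in>W. r {z, a, b}")
  case True
  then obtain z where z: "z \<in> W" "r {z, a, b}" by blast
  have "linked {a, b, c, d} x y" if "x \<in> W - {z}" "y \<in> W - {z}" for x y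
  proof -
    have "blue {x, c, b}" "blue {b, d, y}"
      using blue_cross[OF z(1) _ _ z(2), of x] blue_cross[OF z(1) _ _ z(2), of y] that
      by (auto simp: insert_commute)
    then show ?thesis
      using dist unfolding linked_def by (intro exI[of _ c] exI[of _ b] exI[of _ d]) auto
  qed
  then show ?thesis using flexible by blast
next
  case ab: False
  show ?thesis
  proof (cases "\<forall>x\<in>W. \<forall>y\<in>W. x \<noteq> y \<longrightarrow> linked {a, b, c, d} x y")
    case True
    then show ?thesis using flexible by blast
  next
    case False
    then obtain x y where xy: "x \<in> W" "y \<in> W" "x \<noteq> y" and nl: "\<not> linked {a, b, c, d} x y"
      by blast
    have cross: "r {a, c, v} \<and> r {a, d, v} \<and> r {b, c, v} \<and> r {b, d, v}" if "v \<in> {x, y}" for v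
      using that unlinked_cross[OF nl] unlinked_cross[of y x] nl linked_sym[of _ y x] ab xy by blast
    \<comment> \<open>Both \<open>x\<close> and \<open>y\<close> have these red triples, so one
      different from \<open>w\<close> is always at hand.\<close>
    have other: "\<exists>v\<in>W. v \<noteq> w \<and> r {a, c, v} \<and> r {a, d, v} \<and> r {b, c, v} \<and> r {b, d, v}" for w
      using xy cross[of x] cross[of y] by (cases "x = w") auto
    show ?thesis
    proof (rule rigid)
      fix w assume w: "w \<in> W"
      obtain v where v: "v \<in> W" "v \<noteq> w" "r {a, c, v}" "r {a, d, v}" "r {b, c, v}" "r {b, d, v}"
        using other by blast
      note blue_w = blue_from_cross[OF v(1) w v(2-6)]
      show "blue {w, a, b} \<and> blue {w, b, e} \<and> blue {w, c, e}"
        using ab w blue_w(1,2) by blast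
      show "blue {w, c, f} \<and> blue {w, d, f}" if "post = f # g # post'" for f g post'
        using blue_w(3,4) that by blast
    qed
  qed
qed

end

subsection \<open>Linking the pieces\<close>

context path_free
begin

text \<open>\<open>z\<close> and \<open>u\<close> are kept in reserve for prolonging
  \<open>Q\<close> later. Either of the last two vertices of \<open>L\<close> may be
  \<open>u\<close>, as they can be exchanged.\<close>

definition blue_chain :: "'a list \<Rightarrow> 'a set \<Rightarrow> 'a set \<Rightarrow> nat \<Rightarrow> 'a \<Rightarrow> bool" where
  "blue_chain L A U k x \<longleftrightarrow> (\<exists>Q z u. lpath blue Q \<and> distinct Q \<and> length Q = 4 * k + 1 \<and>
     hd Q = x \<and> last Q \<in> U \<and> set Q \<subseteq> U \<union> (A - {u}) \<and> z \<in> U - set Q \<and>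
     u \<in> A \<and> u \<in> {last L, last (butlast L)})"

lemma blue_chain_Cons:
  assumes "blue_chain L A' (U - {x}) k y" "y \<in> U - {x}" "x \<in> U"
    and "blue {x, p, q}" "blue {q, s, y}" "distinct [p, q, s]"
    and "{p, q, s} \<subseteq> A - A'" "A' \<subseteq> A" "U \<inter> A = {}"
  shows "blue_chain L A U (Suc k) x"
proof -
  obtain Q z u where Q: "lpath blue Q" "distinct Q" "length Q = 4 * k + 1" "hd Q = y"
      "last Q \<in> U - {x}" "set Q \<subseteq> U - {x} \<union> (A' - {u})" "z \<in> U - {x} - set Q" "u \<in> A'"
      "u \<in> {last L, last (butlast L)}"
    using assms(1) unfolding blue_chain_def by blast
  obtain Q' where Q': "Q = y # Q'"
    using Q(3,4) by (cases Q) auto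
  let ?Q = "x # p # q # s # Q"
  have "lpath blue ?Q" "length ?Q = 4 * Suc k + 1" "hd ?Q = x"
    using assms(4,5) Q(1,3) Q' by simp_all
  moreover have "distinct ?Q"
    using Q(2,6) assms(3,6-9) by auto
  moreover have "set ?Q \<subseteq> U \<union> (A - {u})" "z \<in> U - set ?Q" "last ?Q \<in> U" "u \<in> A"
    using Q(5-8) Q' assms(3,7-9) by auto
  ultimately show ?thesis
    using Q(9) unfolding blue_chain_def by blast
qed

text \<open>The exceptional set \<open>Z\<close> of starting points may have any size below \<open>card U\<close>: a start must avoid
  the bad vertex of its own pair, and its successor also that of the next pair.\<close>

lemma blue_chain_exists:
  assumes "max_red_path L" "L = pre @ a # rest" "even (length pre)" "length rest = 4 * k"
    and "U \<subseteq> V - set L" "finite U" "k + 2 \<le> card U"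
  shows "\<exists>Z. finite Z \<and> card Z \<le> k \<and> (\<forall>x\<in>U - Z. blue_chain L (set (a # rest)) U k x)"
  using assms
\<comment> \<open>Strong induction, since the rigid case can consume two pairs at once.\<close>
proof (induction k arbitrary: pre a rest U rule: less_induct)
  case (less k)
  note L = less.prems(1) and L_eq = less.prems(2) and U = less.prems(5) and fin = less.prems(6)
  consider "k = 0" | j where "k = Suc j" by (cases k) auto
  then show ?case
  proof cases
    case 1
    have "blue_chain L (set (a # rest)) U 0 x" if "x \<in> U" for x
    proof -
      obtain z where "z \<in> U - {x}"
        using obtain_notin_smaller[of U "{x}"] fin less.prems(7) 1 by auto
      then show ?thesis
        using that less.prems(2,4) 1 unfolding blue_chain_def
        by (intro exI[of _ "[x]"] exI[of _ z] exI[of _ a]) auto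
    qed
    then show ?thesis using 1 by (intro exI[of _ "{}"]) auto
  next
    case (2 j)
    obtain b c d e rest' where rest: "rest = b # c # d # e # rest'"
      by (rule length_ge_4E[of rest]) (use less.prems(4) 2 in auto)
    interpret two_edges r V n pre rest' a b c d e U
      by unfold_locales (use L L_eq U rest less.prems(3) in auto)
    have distL: "distinct (a # rest)" and disj: "U \<inter> set (a # rest) = {}"
      using L L_eq U by (auto simp: max_red_path_def)
    show ?thesis
    proof (cases rule: flexible_or_rigid)
      case (flexible z)
      have "blue_chain L (set (a # rest)) U k x" if x: "x \<in> U - {z}" for x
      proof -
        have card: "j + 2 \<le> card (U - {x})"
          using less.prems(7) 2 x fin by simp
        have "\<exists>Z. finite Z \<and> card Z \<le> j \<and> (\<forall>y\<in>U - {x} - Z. blue_chain L (set (e # rest')) (U - {x}) j y)"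
          using L L_eq U fin card less.prems(3,4) rest 2
          by (intro less.IH[of j "pre @ [a, b, c, d]" e rest']) auto
        then obtain Z where Z: "finite Z" "card Z \<le> j"
          "\<And>y. y \<in> U - {x} - Z \<Longrightarrow> blue_chain L (set (e # rest')) (U - {x}) j y" by blast
        \<comment> \<open>\<open>Z\<close> and \<open>z\<close> together exclude at most j + 1 of
          the at least j + 2 candidates for \<open>y\<close>.\<close>
        have "card (insert z Z) < card (U - {x})"
          using card_insert_le_m1[of "j + 1" Z z] Z(2) card by simp
        then obtain y where y: "y \<in> U - {x} - insert z Z"
          using obtain_notin_smaller[of "U - {x}" "insert z Z"] fin Z(1) by blast
        then have "linked {a, b, c, d} x y"
          using flexible x by blast
        then obtain p q s where pqs: "{p, q, s} \<subseteq> {a, b, c, d}" "distinct [p, q, s]"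
          "blue {x, p, q}" "blue {q, s, y}" unfolding linked_def by blast
        have "{p, q, s} \<subseteq> set (a # rest) - set (e # rest')"
          using pqs(1) distL rest by auto
        moreover have "y \<in> U - {x} - Z" "y \<in> U - {x}" "x \<in> U" using x y by blast+
        moreover have "set (e # rest') \<subseteq> set (a # rest)" using rest by auto
        ultimately show ?thesis
          unfolding 2 using blue_chain_Cons[OF Z(3) _ _ pqs(3,4,2)] disj by blast
      qed
      then show ?thesis using 2 by (intro exI[of _ "{z}"]) auto
    next
      case rigid
      have "blue_chain L (set (a # rest)) U k x" if x: "x \<in> U" for x
      proof -
        obtain w where w: "w \<in> U - {x}"
          using obtain_notin_smaller[of U "{x}"] fin less.prems(7) 2 by auto
        consider "j = 0" | i where "j = Suc i" by (cases j) auto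
        then show ?thesis
        proof cases
          case 1
          have "card {x, w} < card U"
            using less.prems(7) 2 1 card_insert_le_m1[of 2 "{w}" x] by simp
          then obtain z where "z \<in> U - {x, w}"
            using obtain_notin_smaller[of U "{x, w}"] fin by blast
          moreover have "blue {x, b, e}" "blue {e, c, w}"
            using rigid(1)[of x] rigid(1)[of w] x w by (auto simp: insert_commute)
          moreover have "rest' = []" using less.prems(4) 2 1 rest by simp
          \<comment> \<open>The last pair gives x, b, e, c, w. This spends the last vertex
            \<open>e\<close>, so \<open>d\<close>, the last but one, is kept as
            \<open>u\<close>.\<close>
          ultimately show ?thesis
            using x w distL disj 2 1 L_eq rest unfolding blue_chain_def
            by (intro exI[of _ "[x, b, e, c, w]"] exI[of _ z] exI[of _ d]) (auto simp: butlast_append)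
        next
          case j: (2 i)
          obtain f g h a' rest'' where rest': "rest' = f # g # h # a' # rest''"
            by (rule length_ge_4E[of rest']) (use less.prems(4) 2 j rest in auto)
          have card: "i + 2 \<le> card (U - {x} - {w})"
            using less.prems(7) 2 j x w fin by simp
          have "\<exists>Z. finite Z \<and> card Z \<le> i \<and>
              (\<forall>y\<in>U - {x} - {w} - Z. blue_chain L (set (a' # rest'')) (U - {x} - {w}) i y)"
            using L L_eq U fin card less.prems(3,4) rest rest' 2 j
            by (intro less.IH[of i "pre @ [a, b, c, d, e, f, g, h]" a' rest'']) auto
          then obtain Z where Z: "finite Z" "card Z \<le> i"
            "\<And>y. y \<in> U - {x} - {w} - Z \<Longrightarrow> blue_chain L (set (a' # rest'')) (U - {x} - {w}) i y"
            by blast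
          obtain y where y: "y \<in> U - {x} - {w} - Z"
            using obtain_notin_smaller[of "U - {x} - {w}" Z] fin Z card by auto
          have "blue {x, a, b}" "blue {b, e, w}" "blue {w, c, f}" "blue {f, d, y}"
            using rigid(1)[of x] rigid(1)[of w] rigid(2)[OF _ rest', of w] rigid(2)[OF _ rest', of y]
              x w y by (auto simp: insert_commute)
          note blue = this
          \<comment> \<open>The two pairs give the links x, a, b, e, w and w, c, f, d, y.
            \<open>?A\<close> is what the second link and the remaining chain may use.\<close>
          let ?A = "set (a' # rest'') \<union> {c, f, d}"
          have sets: "{c, f, d} \<subseteq> ?A - set (a' # rest'')" "{a, b, e} \<subseteq> set (a # rest) - ?A"
              "?A \<subseteq> set (a # rest)" "distinct [c, f, d]" "distinct [a, b, e]"
            using distL rest rest' by auto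
          have "(U - {x}) \<inter> ?A = {}" using sets(3) disj by blast
          moreover have "y \<in> U - {x} - {w}" using y by blast
          ultimately have "blue_chain L ?A (U - {x}) (Suc i) w"
            using blue_chain_Cons[OF Z(3)[OF y] _ w blue(3,4) sets(4,1)] by blast
          then show ?thesis
            unfolding 2 j
            using blue_chain_Cons[OF _ w x blue(1,2) sets(5,2,3) disj] by blast
        qed
      qed
      then show ?thesis by (intro exI[of _ "{}"]) auto
    qed
  qed
qed

end

subsection \<open>Red cycles\<close>

context path_free
begin

text \<open>For each j below k the path runs through \<open>w j\<close>, \<open>f (4 * j)\<close>,
  \<open>f (4 * j + 1)\<close>, \<open>f (4 * j + 3)\<close>, \<open>w (Suc j)\<close>.\<close>

lemma blue_chain_across:
  fixes f w :: "nat \<Rightarrow> 'a"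
  assumes "\<And>i j. j \<le> k \<Longrightarrow> blue {w j, f (2 * i), f (2 * i + 1)}"
    and "\<And>i j. j \<le> k \<Longrightarrow> blue {w j, f (2 * i + 1), f (2 * i + 3)}"
    and "inj_on w {..k}" "inj_on f {..<4 * k}" "w ` {..k} \<inter> f ` {..<4 * k} = {}"
  shows "\<exists>Q. lpath blue Q \<and> distinct Q \<and> length Q = 4 * k + 1 \<and> hd Q = w 0 \<and> last Q = w k \<and>
    set Q \<subseteq> w ` {..k} \<union> f ` {..<4 * k}"
  using assms
proof (induction k)
  case 0
  then show ?case by (intro exI[of _ "[w 0]"]) auto
next
  case (Suc k)
  have "\<exists>Q. lpath blue Q \<and> distinct Q \<and> length Q = 4 * k + 1 \<and> hd Q = w 0 \<and> last Q = w k \<and>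
    set Q \<subseteq> w ` {..k} \<union> f ` {..<4 * k}"
  proof (rule Suc.IH)
    show "inj_on w {..k}" "inj_on f {..<4 * k}"
      using Suc.prems(3,4) by (auto intro: inj_on_subset)
    show "w ` {..k} \<inter> f ` {..<4 * k} = {}"
    proof -
      have "w ` {..k} \<inter> f ` {..<4 * k} \<subseteq> w ` {..Suc k} \<inter> f ` {..<4 * Suc k}"
        by (intro Int_mono image_mono) auto
      then show ?thesis using Suc.prems(5) by blast
    qed
  qed (use Suc.prems(1,2) in auto)
  then obtain Q where Q: "lpath blue Q" "distinct Q" "length Q = 4 * k + 1" "hd Q = w 0"
    "last Q = w k" "set Q \<subseteq> w ` {..k} \<union> f ` {..<4 * k}" by blast
  let ?Q = "(Q @ [f (4 * k), f (4 * k + 1)]) @ [f (4 * k + 3), w (Suc k)]"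
  have "blue {w k, f (4 * k), f (4 * k + 1)}" "blue {f (4 * k + 1), f (4 * k + 3), w (Suc k)}"
    using Suc.prems(1)[of k "2 * k"] Suc.prems(2)[of "Suc k" "2 * k"]
    by (simp_all add: insert_commute)
  then have "lpath blue ?Q"
    using Q(1,5) by (intro lpath_snoc) auto
  moreover have "distinct ?Q"
  proof -
    have wf: "w i \<noteq> f j" if "i \<le> Suc k" "j < 4 * Suc k" for i j
      using Suc.prems(5) that by blast
    have ff: "f i \<noteq> f j" if "i < 4 * Suc k" "j < 4 * Suc k" "i \<noteq> j" for i j
      using Suc.prems(4) that unfolding inj_on_def by blast
    have ww: "w i \<noteq> w (Suc k)" if "i \<le> k" for i
      using inj_onD[OF Suc.prems(3), of i "Suc k"] that by auto
    have fQ: "f i \<notin> set Q" if "4 * k \<le> i" "i < 4 * k + 4" for i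
    proof
      assume "f i \<in> set Q"
      then consider j where "j \<le> k" "f i = w j" | j where "j < 4 * k" "f i = f j"
        using Q(6) by blast
      then show False
      proof cases
        case (1 j)
        then show False using wf[of j i] that by simp
      next
        case (2 j)
        then show False using ff[of i j] that by simp
      qed
    qed
    have "w (Suc k) \<notin> set Q"
    proof
      assume "w (Suc k) \<in> set Q"
      then consider j where "j \<le> k" "w (Suc k) = w j" | j where "j < 4 * k" "w (Suc k) = f j"
        using Q(6) by blast
      then show False
      proof cases
        case (1 j)
        then show False using ww[of j] by metis
      next
        case (2 j)
        then show False using wf[of "Suc k" j] by simp
      qed
    qed
    then show ?thesis
      using Q(2) ff[of "4 * k" "4 * k + 1"] ff[of "4 * k" "4 * k + 3"] ff[of "4 * k + 1" "4 * k + 3"]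
        wf[of "Suc k" "4 * k"] wf[of "Suc k" "4 * k + 1"] wf[of "Suc k" "4 * k + 3"]
        fQ[of "4 * k"] fQ[of "4 * k + 1"] fQ[of "4 * k + 3"] by simp
  qed
  moreover have "set ?Q \<subseteq> w ` {..Suc k} \<union> f ` {..<4 * Suc k}"
    using Q(6) by fastforce
  moreover have "hd ?Q = w 0"
    using Q(3,4) by (cases Q) auto
  ultimately show ?case
    using Q(3) by (intro exI[of _ ?Q]) simp
qed

text \<open>\<open>x\<close> closes \<open>L\<close> to a red cycle. Removing the inner vertex of
  any cycle edge leaves a red path with n - 1 edges, so \<open>blue_end\<close> applies all around
  the cycle. The blue path from \<open>blue_chain_across\<close> is then prolonged by one edge at
  each end.\<close>

lemma red_cycle:
  assumes L: "max_red_path L" and x: "x \<in> V - set L" "r {hd L, x, last L}" and n: "2 \<le> n"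
    and W: "W \<subseteq> V - insert x (set L)" "finite W" "card W = k + 1" and k: "4 * k + 4 \<le> 2 * n"
  shows "has_lpath blue V (2 * k + 2)"
proof -
  \<comment> \<open>\<open>f\<close> runs around the cycle periodically; even indices are the
    joints, and \<open>x\<close> sits at 2n - 1.\<close>
  define f where "f j = (L @ [x]) ! (j mod (2 * n))" for j
  have len: "length (L @ [x]) = 2 * n" and "L \<noteq> []"
    using L n by (auto simp: max_red_path_def)
  have dist: "distinct (L @ [x])"
    using L x(1) by (simp add: max_red_path_def)
  have range_f: "f j \<in> insert x (set L)" for j
    using nth_mem[of "j mod (2 * n)" "L @ [x]"] len n unfolding f_def by simp
  have fV: "f j \<in> V" for j
    using range_f[of j] L x(1) unfolding max_red_path_def by auto
  have per: "f (j + 2 * n) = f j" for j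
    by (simp add: f_def)
  have inj: "inj_on f {s..<s + 2 * n}" for s
  proof (rule inj_onI)
    fix i j assume *: "i \<in> {s..<s + 2 * n}" "j \<in> {s..<s + 2 * n}" "f i = f j"
    then have "i mod (2 * n) = j mod (2 * n)"
      using nth_eq_iff_index_eq[OF dist] len n unfolding f_def by simp
    then show "i = j"
      using * mod_eq_dvd_iff_nat[of i j "2 * n"] mod_eq_dvd_iff_nat[of j i "2 * n"]
      by (cases i j rule: linorder_cases) (auto dest!: dvd_imp_le)
  qed
  have red: "r {f (2 * i), f (2 * i + 1), f (2 * i + 2)}" for i
  proof -
    have f_even: "f (2 * i) = (L @ [x]) ! (2 * (i mod n))"
      and f_odd: "f (2 * i + 1) = (L @ [x]) ! (2 * (i mod n) + 1)" for i
      by (simp_all add: f_def mod_mult2_eq)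
    show ?thesis
    proof (cases "Suc (i mod n) = n")
      case True
      then have "Suc i mod n = 0" by (simp add: mod_Suc)
      then have "f (2 * i + 2) = hd L"
        using f_even[of "Suc i"] \<open>L \<noteq> []\<close> by (simp add: nth_append hd_conv_nth)
      moreover have "f (2 * i) = last L" "f (2 * i + 1) = x"
        using True f_even[of i] f_odd[of i] len \<open>L \<noteq> []\<close>
        by (auto simp: nth_append last_conv_nth intro: arg_cong[of _ _ "(!) L"])
      ultimately show ?thesis using x(2) by (simp add: insert_commute)
    next
      case False
      then have "i mod n + 1 < n" "Suc i mod n = i mod n + 1"
        using mod_less_divisor[of n i] n by (simp_all add: mod_Suc Suc_lessI)
      then show ?thesis
        using f_even[of i] f_odd[of i] f_even[of "Suc i"] len L lpath_nth[of r L "i mod n"]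
        by (simp add: nth_append max_red_path_def)
    qed
  qed
  have rot: "max_red_path (map f [2 * i + 2..<2 * i + 2 + 2 * (n - 1) + 1])" for i
  proof -
    have "lpath r (map f [2 * i + 2..<2 * i + 2 + 2 * (n - 1) + 1])"
      using red[of "i + 1 + j" for j] by (intro lpath_map_upt) (simp add: algebra_simps)
    moreover have "inj_on f {2 * i + 2..<2 * i + 2 + 2 * (n - 1) + 1}"
      using inj[of "2 * i + 2"] by (rule inj_on_subset) (use n in auto)
    moreover have "f ` {2 * i + 2..<2 * i + 2 + 2 * (n - 1) + 1} \<subseteq> V"
      using fV by blast
    ultimately show ?thesis
      using n unfolding max_red_path_def by (simp add: distinct_map del: upt_Suc)
  qed
  obtain m where m: "n = m + 2" using n by (metis add.commute le_Suc_ex)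
  have notin: "f (2 * i + 1) \<in> V - f ` {2 * i + 2..<2 * i + 2 + 2 * (n - 1) + 1}"
    for i
  proof -
    have "f (2 * i + 1) \<noteq> f j" if "j \<in> {2 * i + 2..<2 * i + 2 + 2 * (n - 1) + 1}" for j
      using inj_onD[OF inj[of "2 * i + 1"], of "2 * i + 1" j] that by (auto simp: m)
    then show ?thesis using fV by blast
  qed
  have outer: "w \<in> V - f ` {2 * i + 2..<2 * i + 2 + 2 * (n - 1) + 1} \<and> f j \<noteq> w" if "w \<in> W" for w i j
    using that W range_f by blast
  have b1: "blue {w, f (2 * i), f (2 * i + 1)}" if w: "w \<in> W" for w i
  proof -
    have "last (map f [2 * i + 2..<2 * i + 2 + 2 * (n - 1) + 1]) = f (2 * i)"
      using per[of "2 * i"] by (simp add: m algebra_simps)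
    then show ?thesis
      using blue_end[OF rot[of i], of "f (2 * i + 1)" w] notin[of i] outer[OF w, of i "2 * i + 1"]
      by (simp add: insert_commute del: upt_Suc)
  qed
  \<comment> \<open>The path without \<open>f (2 * i + 3)\<close> ends in
    \<open>f (2 * i + 1)\<close> once its last two vertices are swapped.\<close>
  have b2: "blue {w, f (2 * i + 1), f (2 * i + 3)}" if w: "w \<in> W" for w i
  proof -
    let ?s = "2 * Suc i + 2"
    let ?xs = "map f [?s..<?s + 2 * m]"
    have split: "map f [?s..<?s + 2 * (n - 1) + 1] =
        ?xs @ [f (?s + 2 * m), f (?s + 2 * m + 1), f (?s + 2 * m + 2)]"
      by (simp add: m)
    have "f (?s + 2 * m + 1) = f (2 * i + 1)"
      using per[of "2 * i + 1"] by (simp add: m algebra_simps)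
    then have last: "last (?xs @ [f (?s + 2 * m), f (?s + 2 * m + 2), f (?s + 2 * m + 1)]) = f (2 * i + 1)"
      by simp
    have set: "set (?xs @ [f (?s + 2 * m), f (?s + 2 * m + 2), f (?s + 2 * m + 1)]) =
       f ` {?s..<?s + 2 * (n - 1) + 1}"
    proof -
      have "set (?xs @ [f (?s + 2 * m), f (?s + 2 * m + 2), f (?s + 2 * m + 1)]) =
          set (map f [?s..<?s + 2 * (n - 1) + 1])"
        unfolding split by (simp only: set_append list.set insert_commute)
      then show ?thesis by (simp only: set_map set_upt)
    qed
    have "max_red_path (?xs @ [f (?s + 2 * m), f (?s + 2 * m + 2), f (?s + 2 * m + 1)])"
      using swap_last rot[of "Suc i"] split by simp
    from blue_end[OF this, of "f (2 * Suc i + 1)" w, unfolded last set] show ?thesis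
      using notin[of "Suc i"] outer[OF w, of "Suc i" "2 * Suc i + 1"]
      by (simp add: insert_commute numeral_eq_Suc)
  qed
  obtain w where w: "bij_betw w {0..<card W} W"
    using ex_bij_betw_nat_finite[OF W(2)] by blast
  have range_w: "w j \<in> W" if "j \<le> k" for j
    using bij_betwE[OF w] that W(3) by auto
  have wf: "w i \<noteq> f j" if "i \<le> k" for i j
    using range_w[OF that] W(1) range_f[of j] by auto
  have "\<exists>Q. lpath blue Q \<and> distinct Q \<and> length Q = 4 * k + 1 \<and> hd Q = w 0 \<and> last Q = w k \<and>
      set Q \<subseteq> w ` {..k} \<union> f ` {..<4 * k}"
  proof (rule blue_chain_across)
    show "blue {w j, f (2 * i), f (2 * i + 1)}" "blue {w j, f (2 * i + 1), f (2 * i + 3)}"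
      if "j \<le> k" for i j
      using b1 b2 range_w[OF that] by blast+
    have "{..k} = {0..<card W}" using W(3) by auto
    then show "inj_on w {..k}"
      using w by (simp add: bij_betw_def)
    show "inj_on f {..<4 * k}"
      using inj[of 0] by (rule inj_on_subset) (use k in auto)
    show "w ` {..k} \<inter> f ` {..<4 * k} = {}"
      using wf by blast
  qed
  then obtain Q where Q: "lpath blue Q" "distinct Q" "length Q = 4 * k + 1" "hd Q = w 0"
    "last Q = w k" "set Q \<subseteq> w ` {..k} \<union> f ` {..<4 * k}" by blast
  have ff: "f (4 * k + i) \<noteq> f j" if "i < 4" "j < 4 * k + i" for i j
    using inj[of 0] k that unfolding inj_on_def by force
  have fresh: "f (4 * k + i) \<notin> set Q" if "i < 4" for i
  proof
    assume "f (4 * k + i) \<in> set Q"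
    then consider j where "j \<le> k" "f (4 * k + i) = w j" | j where "j < 4 * k" "f (4 * k + i) = f j"
      using Q(6) by blast
    then show False
    proof cases
      case (1 j)
      then show False using wf[of j "4 * k + i"] by simp
    next
      case (2 j)
      then show False using ff[OF that, of j] by simp
    qed
  qed
  \<comment> \<open>The next four cycle vertices supply the two end edges; hence the bound
    \<open>4 * k + 4 \<le> 2 * n\<close>.\<close>
  let ?Q = "f (4 * k) # f (4 * k + 1) # Q @ [f (4 * k + 2), f (4 * k + 3)]"
  have "blue {w k, f (4 * k + 2), f (4 * k + 3)}"
  proof -
    have idx: "2 * (2 * k + 1) = 4 * k + 2" "4 * k + 2 + 1 = 4 * k + 3" by simp_all
    show ?thesis using b1[OF range_w[OF order_refl], of "2 * k + 1"] unfolding idx .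
  qed
  then have "lpath blue (Q @ [f (4 * k + 2), f (4 * k + 3)])"
    using Q(1,5) by (intro lpath_snoc) auto
  moreover obtain Q' where "Q = w 0 # Q'"
    using Q(3,4) by (cases Q) auto
  moreover have "blue {f (4 * k), f (4 * k + 1), w 0}"
    using b1[OF range_w, of 0 "2 * k"] by (simp add: insert_commute)
  ultimately have "lpath blue ?Q" by simp
  moreover have "distinct ?Q"
    using Q(2) fresh[of 0] fresh[of 1] fresh[of 2] fresh[of 3] ff[of 1 "4 * k"] ff[of 2 "4 * k"]
      ff[of 3 "4 * k"] ff[of 2 "4 * k + 1"] ff[of 3 "4 * k + 1"] ff[of 3 "4 * k + 2"] by simp
  moreover have "set ?Q \<subseteq> V"
  proof -
    have "w ` {..k} \<subseteq> V" using range_w W(1) by blast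
    then have "set Q \<subseteq> V" using Q(6) fV by blast
    then show ?thesis using fV by simp
  qed
  ultimately show ?thesis
    using Q(3) by (intro has_lpathI[of blue ?Q]) auto
qed

end

subsection \<open>The Ramsey number\<close>

context path_free
begin

text \<open>Only the last two vertices may be exchanged, so the beginning of \<open>L\<close>,
  needed for even m, stays in place.\<close>

lemma reorient_last:
  assumes "max_red_path L" "2 \<le> length L" "u \<in> {last L, last (butlast L)}"
  obtains L' where "max_red_path L'" "set L' = set L" "last L' = u"
    "\<And>k. k + 2 \<le> length L \<Longrightarrow> take k L' = take k L"
proof (cases "u = last L")
  case True
  then show ?thesis using assms(1) that by blast
next
  case False
  have "odd (length L)"
    using assms(1) odd_length_lpath unfolding max_red_path_def by blast
  with assms(2) have "3 \<le> length (rev L)" by (cases "length L = 2") auto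
  then obtain e d c ys where "rev L = e # d # c # ys"
    by (auto simp: numeral_eq_Suc Suc_le_length_iff simp del: length_rev)
  then have L: "L = rev ys @ [c, d, e]"
    by (metis append.assoc append_Cons append_Nil rev.simps(2) rev_rev_ident)
  have "u = d" using False assms(3) L by (simp add: butlast_append)
  moreover have "max_red_path (rev ys @ [c, e, d])" using assms(1) swap_last L by blast
  moreover have "take k (rev ys @ [c, e, d]) = take k L" if "k + 2 \<le> length L" for k
    using that unfolding L by (cases "k - length ys = 0") (auto simp: take_Cons' )
  ultimately show ?thesis
    by (intro that[of "rev ys @ [c, e, d]"]) (auto simp: L)
qed

lemma blue_path_outside_max:
  assumes L: "max_red_path L" and fin: "finite V" and mn: "2 \<le> m" "m \<le> n" "3 \<le> n"
    and card: "2 * n + (m + 1) div 2 \<le> card V"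
  shows "has_lpath blue V m"
proof -
  define W where "W = V - set L"
  define k where "k = (m - 1) div 2"
  \<comment> \<open>The k pairs occupy the last 4k + 1 of the 2n - 1 vertices of \<open>L\<close>,
    starting at the joint with index \<open>s\<close>.\<close>
  define s where "s = 2 * n - 2 - 4 * k"
  have "length L + 1 = 2 * n" and LV: "set L \<subseteq> V" "distinct L"
    using L by (simp_all add: max_red_path_def)
  then have lenL: "length L = 2 * n - 1" by linarith
  \<comment> \<open>At least (m + 1) div 2 + 1 = k + 2 vertices lie off \<open>L\<close>.\<close>
  have finW: "finite W" and cardW: "k + 2 \<le> card W"
    using fin card mn card_Diff_subset[of "set L" V] LV lenL distinct_card[of L]
    by (auto simp: W_def k_def)
  have k: "4 * k \<le> 2 * n - 2" using mn by (auto simp: k_def)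
  then have s: "s < length L" "length (drop (Suc s) L) = 4 * k" "even s"
    using lenL mn by (auto simp: s_def)
  let ?A = "set (drop s L)"
  have split: "L = take s L @ L ! s # drop (Suc s) L"
    using id_take_nth_drop[OF s(1)] .
  have "\<exists>Z. finite Z \<and> card Z \<le> k \<and>
      (\<forall>x\<in>W - Z. blue_chain L (set (L ! s # drop (Suc s) L)) W k x)"
    using s finW cardW by (intro blue_chain_exists[OF L split]) (auto simp: W_def)
  then obtain Z where Z: "finite Z" "card Z \<le> k" "\<And>x. x \<in> W - Z \<Longrightarrow> blue_chain L ?A W k x"
    unfolding Cons_nth_drop_Suc[OF s(1)] by blast
  obtain x where "x \<in> W - Z"
    using obtain_notin_smaller[OF finW Z(1)] Z(2) cardW by auto
  then have "blue_chain L ?A W k x" by (rule Z(3))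
  then obtain Q z u where Q: "lpath blue Q" "distinct Q" "length Q = 4 * k + 1"
      "last Q \<in> W" "set Q \<subseteq> W \<union> (?A - {u})" "z \<in> W - set Q" "u \<in> ?A"
      "u \<in> {last L, last (butlast L)}"
    unfolding blue_chain_def by blast
  have "Q \<noteq> []" using Q(3) by auto
  then have lastQ: "last Q \<in> set Q" by simp
  have A: "?A \<subseteq> set L" by (rule set_drop_subset)
  obtain L' where L': "max_red_path L'" "set L' = set L" "last L' = u"
    "\<And>k. k + 2 \<le> length L \<Longrightarrow> take k L' = take k L"
    by (rule reorient_last[OF L _ Q(8)]) (use lenL mn in auto)
  show ?thesis
  proof (cases "odd m")
    case True
    then have m: "m = 2 * k + 1" by (auto simp: k_def elim: oddE)
    have "blue {u, last Q, z}"
      using blue_end[OF L'(1), of "last Q" z] L'(2,3) Q(4,6) lastQ by (auto simp: W_def)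
    then have "lpath blue (Q @ [u, z])"
      using Q(1) by (intro lpath_snoc) (auto simp: insert_commute)
    moreover have "distinct (Q @ [u, z])" "set (Q @ [u, z]) \<subseteq> V"
      using Q(2,5-7) A LV by (auto simp: W_def)
    ultimately show ?thesis
      using Q(3) m by (intro has_lpathI[of blue "Q @ [u, z]"]) auto
  next
    case False
    then have m: "m = 2 * k + 2" using mn by (auto simp: k_def elim: evenE)
    \<comment> \<open>For m = 2k + 2 the hypothesis m \<le> n makes room for two vertices in front
      of all pairs.\<close>
    then have s2: "2 \<le> s" using mn by (simp add: s_def)
    obtain v0 v1 v2 ys where L'_eq: "L' = v0 # v1 # v2 # ys"
    proof -
      have "3 \<le> length L'" using L'(1) mn by (simp add: max_red_path_def)
      then show ?thesis using that by (auto simp: numeral_eq_Suc Suc_le_length_iff)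
    qed
    have "take 2 L = [v0, v1]"
      using L'(4)[of 2] L'_eq lenL mn by (simp add: numeral_eq_Suc)
    then have "set [v0, v1] \<subseteq> set (take s L)"
      using set_take_subset_set_take[of 2 s L] s2 by (metis min_def take_take)
    moreover have "set (take s L) \<inter> ?A = {}"
      using LV(2) append_take_drop_id[of s L] by (metis distinct_append)
    ultimately have v: "v0 \<notin> ?A" "v1 \<notin> ?A" by auto
    have vL: "v0 \<in> set L" "v1 \<in> set L" "v0 \<noteq> v1"
      using L'(1,2) L'_eq by (auto simp: max_red_path_def)
    show ?thesis
    proof (rule ccontr)
      assume no: "\<not> has_lpath blue V m"
      \<comment> \<open>Closing the cycle would spend only \<open>w\<close>, and k + 1 other
        vertices of \<open>W\<close> suffice for \<open>red_cycle\<close>.\<close>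
      have closing: "blue {hd L'', w, last L''}" if "max_red_path L''" "set L'' = set L" "w \<in> W" for L'' w
      proof
        assume "r {hd L'', w, last L''}"
        moreover have "k + 1 \<le> card (W - {w})" using cardW finW that(3) by simp
        then obtain W' where "W' \<subseteq> W - {w}" "card W' = k + 1" "finite W'"
          by (metis obtain_subset_with_card_n finW finite_Diff finite_subset)
        ultimately have "has_lpath blue V (2 * k + 2)"
          using that mn m by (intro red_cycle[of L'' w W' k]) (auto simp: W_def)
        then show False using no m by simp
      qed
      have "blue {v0, last Q, u}"
        using closing[of L' "last Q"] L' Q(4) L'_eq by auto
      \<comment> \<open>\<open>v0\<close> and \<open>v1\<close> can be exchanged, so either may be
        the head of the path.\<close>
      moreover have "blue {v1, z, u}"
        using closing[of "v1 # v0 # v2 # ys" z] swap_hd[of v0 v1 v2 ys] L' Q(6) L'_eq by auto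
      ultimately have "lpath blue ((Q @ [v0, u]) @ [v1, z])"
        using Q(1) by (intro lpath_snoc) (auto simp: insert_commute)
      moreover have "distinct ((Q @ [v0, u]) @ [v1, z])" "set ((Q @ [v0, u]) @ [v1, z]) \<subseteq> V"
        using Q(2,5-7) A LV v vL by (auto simp: W_def)
      ultimately have "has_lpath blue V m"
        using Q(3) m by (intro has_lpathI[of blue "(Q @ [v0, u]) @ [v1, z]"]) auto
      with no show False ..
    qed
  qed
qed

end

text \<open>Five triples on five points form a cycle of odd length in which neighbours share exactly one
  vertex; they cannot alternate in colour.\<close>

lemma two_edge_paths:
  assumes "finite V" "5 \<le> card V"
  shows "has_lpath r V 2 \<or> has_lpath (\<lambda>e. \<not> r e) V 2"
proof (rule ccontr)
  assume no: "\<not> ?thesis"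
  obtain T where T: "T \<subseteq> V" "card T = 5" "finite T"
    using obtain_subset_with_card_n[OF assms(2)] by blast
  obtain xs where xs: "set xs = T" "distinct xs" "length xs = 5"
    using finite_distinct_list[OF T(3)] T(2) distinct_card by metis
  then obtain a b c d e where "xs = [a, b, c, d, e]"
    by (auto simp: numeral_eq_Suc length_Suc_conv)
  with xs T have dist: "distinct [a, b, c, d, e]" and sub: "{a, b, c, d, e} \<subseteq> V" by auto
  have alt: "r {p, q, s} \<longleftrightarrow> \<not> r {s, t, u}"
    if "{p, q, s, t, u} = {a, b, c, d, e}" "distinct [p, q, s, t, u]" for p q s t u
    using no that sub has_lpathI[of r "[p, q, s, t, u]" V 2]
      has_lpathI[of "\<lambda>e. \<not> r e" "[p, q, s, t, u]" V 2] by auto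
  have "r {a, b, c} \<longleftrightarrow> \<not> r {c, d, e}" "r {d, c, e} \<longleftrightarrow> \<not> r {e, a, b}"
    "r {a, e, b} \<longleftrightarrow> \<not> r {b, c, d}" "r {b, c, d} \<longleftrightarrow> \<not> r {d, e, a}" "r {e, d, a} \<longleftrightarrow> \<not> r {a, b, c}"
    using dist by (intro alt; auto)+
  then show False by (simp add: insert_commute)
qed

text \<open>The induction supplies a red path with n - 1 edges: from n - 1 and m if m < n, and on
  the diagonal from n and m - 1 with the colours exchanged, because a blue path with n = m edges is
  excluded. This exchange is why \<open>r\<close> is generalized.\<close>

lemma mono_lpath:
  assumes "finite V" "2 \<le> m" "m \<le> n" "2 * n + (m + 1) div 2 \<le> card V"
  shows "has_lpath r V n \<or> has_lpath (\<lambda>e. \<not> r e) V m"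
  using assms
proof (induction "n + m" arbitrary: n m r rule: less_induct)
  case less
  show ?case
  proof (cases "n = 2")
    case True
    then show ?thesis using two_edge_paths less.prems by auto
  next
    case False
    show ?thesis
    proof (rule ccontr)
      assume no: "\<not> ?thesis"
      have "has_lpath r V (n - 1)"
      proof (cases "m < n")
        case True
        then show ?thesis
          using less.hyps[of "n - 1" m r] less.prems no by auto
      next
        case eq: False
        have "n + (m - 1) < n + m" "2 \<le> m - 1" "m - 1 \<le> n" "2 * n + (m - 1 + 1) div 2 \<le> card V"
          using less.prems False eq by auto
        from less.hyps[OF this(1) less.prems(1) this(2-4), of "\<lambda>e. \<not> r e"] show ?thesis
          using no less.prems(3) eq by auto
      qed
      then obtain L where L: "lpath r L" "distinct L" "set L \<subseteq> V" "length L = 2 * (n - 1) + 1"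
        unfolding has_lpath_def by blast
      interpret path_free r V n
        by unfold_locales (use no in blast)
      have "max_red_path L"
        using L less.prems unfolding max_red_path_def by auto
      then show False
        using blue_path_outside_max[of L m] less.prems False no by auto
    qed
  qed
qed

section \<open>From vertex lists to copies of loose paths\<close>

lemma contains_copy_loose_path3:
  assumes "has_lpath (\<lambda>e. c e = x) {1..N} n"
  shows "contains_copy (color_class (complete3 N) c x) (loose_path3 n)"
proof -
  obtain xs where xs: "lpath (\<lambda>e. c e = x) xs" "distinct xs" "set xs \<subseteq> {1..N}" "length xs = 2 * n + 1"
    using assms unfolding has_lpath_def by blast
  define f where "f i = xs ! (i - 1)" for i
  have inj: "inj_on f {1..2 * n + 1}"
    using xs(2,4) unfolding f_def by (intro inj_onI) (auto simp: nth_eq_iff_index_eq)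
  have img: "f ` {1..2 * n + 1} \<subseteq> {1..N}"
  proof
    fix v assume "v \<in> f ` {1..2 * n + 1}"
    then have "v \<in> set xs" using xs(4) unfolding f_def by auto
    then show "v \<in> {1..N}" using xs(3) by blast
  qed
  have "f ` {2 * i + 1, 2 * i + 2, 2 * i + 3} \<in> {e \<in> [{1..N}]\<^bsup>3\<^esup>. c e = x}" if i: "i < n" for i
  proof -
    have sub: "{2 * i + 1, 2 * i + 2, 2 * i + 3} \<subseteq> {1..2 * n + 1}" using i by auto
    have "card (f ` {2 * i + 1, 2 * i + 2, 2 * i + 3}) = 3"
      using card_image[OF inj_on_subset[OF inj sub]] by simp
    moreover have "c (f ` {2 * i + 1, 2 * i + 2, 2 * i + 3}) = x"
      using lpath_nth[OF xs(1), of i] xs(4) i by (simp add: f_def numeral_eq_Suc)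
    moreover have "f ` {2 * i + 1, 2 * i + 2, 2 * i + 3} \<subseteq> {1..N}"
      using image_mono[OF sub, of f] img by (rule order_trans)
    ultimately show ?thesis by (simp add: nsets_def)
  qed
  then show ?thesis
    using inj img unfolding contains_copy_def color_class_def complete3_def loose_path3_def
    by (intro exI[of _ f]) auto
qed

lemma arrows_loose_path3:
  assumes "2 \<le> m" "m \<le> n"
  shows "arrows (2 * n + (m + 1) div 2) (loose_path3 n) (loose_path3 m)"
  unfolding arrows_def
proof
  fix c :: "nat set \<Rightarrow> color"
  let ?N = "2 * n + (m + 1) div 2"
  have "(\<lambda>e. c e \<noteq> Red) = (\<lambda>e. c e = Blue)"
    by (metis color.exhaust color.distinct(1))
  then have "has_lpath (\<lambda>e. c e = Red) {1..?N} n \<or> has_lpath (\<lambda>e. c e = Blue) {1..?N} m"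
    using mono_lpath[of "{1..?N}" m n "\<lambda>e. c e = Red"] assms by simp
  then show "contains_copy (color_class (complete3 ?N) c Red) (loose_path3 n) \<or>
      contains_copy (color_class (complete3 ?N) c Blue) (loose_path3 m)"
    using contains_copy_loose_path3 by blast
qed

section \<open>The lower bound\<close>

lemma not_arrows_loose_path3:
  assumes "0 < n" "0 < m" "N < 2 * n + (m + 1) div 2"
  shows "\<not> arrows N (loose_path3 n) (loose_path3 m)"
proof
  define c where "c e = (if e \<subseteq> {1..2 * n} then Red else Blue)" for e :: "nat set"
  assume "arrows N (loose_path3 n) (loose_path3 m)"
  then consider
      "contains_copy (color_class (complete3 N) c Red) (loose_path3 n)"
    | "contains_copy (color_class (complete3 N) c Blue) (loose_path3 m)"
    unfolding arrows_def by blast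
  then show False
  proof cases
    case 1
    then obtain f where f: "inj_on f (hverts (loose_path3 n))"
        "\<forall>e\<in>hedges (loose_path3 n). f ` e \<in> hedges (color_class (complete3 N) c Red)"
      unfolding contains_copy_def by blast
    have red: "f ` {2 * i + 1, 2 * i + 2, 2 * i + 3} \<subseteq> {1..2 * n}" if "i < n" for i
    proof -
      have "{2 * i + 1, 2 * i + 2, 2 * i + 3} \<in> hedges (loose_path3 n)"
        unfolding loose_path3_def using that by auto
      then have "c (f ` {2 * i + 1, 2 * i + 2, 2 * i + 3}) = Red"
        using f(2) unfolding color_class_def by auto
      then show ?thesis unfolding c_def by (metis color.distinct(1))
    qed
    have "f j \<in> {1..2 * n}" if "j \<in> {1..2 * n + 1}" for j
    proof -
      define i where "i = (if j = 1 then 0 else (j - 2) div 2)"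
      have "i < n" "j \<in> {2 * i + 1, 2 * i + 2, 2 * i + 3}"
        using that assms(1) by (auto simp: i_def)
      then show ?thesis using red by blast
    qed
    then have "f ` {1..2 * n + 1} \<subseteq> {1..2 * n}" by blast
    moreover have "inj_on f {1..2 * n + 1}" using f(1) by (simp add: loose_path3_def)
    ultimately have "card {1..2 * n + 1} \<le> card {1..2 * n}"
      by (intro card_inj_on_le[of f]) auto
    then show False by simp
  next
    case 2
    then obtain f where f: "inj_on f (hverts (loose_path3 m))"
        "f ` hverts (loose_path3 m) \<subseteq> hverts (color_class (complete3 N) c Blue)"
        "\<forall>e\<in>hedges (loose_path3 m). f ` e \<in> hedges (color_class (complete3 N) c Blue)"
      unfolding contains_copy_def by blast
    have inj: "inj_on f {1..2 * m + 1}" and img: "f ` {1..2 * m + 1} \<subseteq> {1..N}"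
      using f(1,2) by (simp_all add: loose_path3_def color_class_def complete3_def)
    have blue: "\<not> f ` {2 * i + 1, 2 * i + 2, 2 * i + 3} \<subseteq> {1..2 * n}" if "i < m" for i
    proof -
      have "{2 * i + 1, 2 * i + 2, 2 * i + 3} \<in> hedges (loose_path3 m)"
        unfolding loose_path3_def using that by auto
      then have "c (f ` {2 * i + 1, 2 * i + 2, 2 * i + 3}) = Blue"
        using f(3) unfolding color_class_def by auto
      then show ?thesis unfolding c_def by (metis color.distinct(1))
    qed
    \<comment> \<open>The edges with even index 2i are pairwise disjoint, so their vertices outside
      the red set differ.\<close>
    have "\<exists>j. j \<in> {4 * i + 1, 4 * i + 2, 4 * i + 3} \<and> f j \<in> {2 * n + 1..N}"
      if "i < (m + 1) div 2" for i
    proof -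
      have i: "2 * i < m" using that by auto
      obtain j where j: "j \<in> {2 * (2 * i) + 1, 2 * (2 * i) + 2, 2 * (2 * i) + 3}" "f j \<notin> {1..2 * n}"
        using blue[OF i] by blast
      then have "f j \<in> {1..N}" using i by (intro subsetD[OF img] imageI) auto
      then show ?thesis using j by (intro exI[of _ j]) auto
    qed
    then obtain g where g: "\<And>i. i < (m + 1) div 2 \<Longrightarrow>
        g i \<in> {4 * i + 1, 4 * i + 2, 4 * i + 3} \<and> f (g i) \<in> {2 * n + 1..N}"
      by metis
    \<comment> \<open>The edge with index 2i lies in the i-th block of four consecutive numbers, so
      \<open>g i\<close> determines i.\<close>
    have g_div: "g i \<in> {1..2 * m + 1}" "(g i - 1) div 4 = i" if "i < (m + 1) div 2" for i
      using g[OF that] that by (elim conjE insertE; simp)+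
    have "inj_on (\<lambda>i. f (g i)) {..<(m + 1) div 2}"
    proof (rule inj_onI)
      fix i j assume ij: "i \<in> {..<(m + 1) div 2}" "j \<in> {..<(m + 1) div 2}" "f (g i) = f (g j)"
      then have "g i = g j"
        using inj_onD[OF inj ij(3)] g_div(1)[of i] g_div(1)[of j] by simp
      then show "i = j" using g_div(2) ij(1,2) by (metis lessThan_iff)
    qed
    then have "card {..<(m + 1) div 2} \<le> card {2 * n + 1..N}"
      using g by (intro card_inj_on_le[of "\<lambda>i. f (g i)"]) auto
    then have "(m + 1) div 2 \<le> N - 2 * n" by simp
    \<comment> \<open>If N < 2n, the truncated difference \<open>N - 2 * n\<close> is 0, and
      positivity gives the contradiction.\<close>
    moreover have "0 < (m + 1) div 2" using assms(2) by auto
    ultimately show False using assms(3) by linarith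
  qed
qed

theorem theorem4p3:
  fixes n m :: nat
  assumes "m \<ge> 3" and "n \<ge> m"
  shows "ramsey_number (loose_path3 n) (loose_path3 m) = 2 * n + (m + 1) div 2"
  unfolding ramsey_number_def
proof (rule Least_equality)
  show "arrows (2 * n + (m + 1) div 2) (loose_path3 n) (loose_path3 m)"
    using arrows_loose_path3 assms by simp
  show "2 * n + (m + 1) div 2 \<le> N" if "arrows N (loose_path3 n) (loose_path3 m)" for N
    using not_arrows_loose_path3[of n m N] that assms by (cases "N < 2 * n + (m + 1) div 2") auto
qed

end
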